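(* (i) Let $r\in\mathbb Z_+$ be even and $\Gamma=\Gamma_{(r,r)}$. For every $E\in(-4,4)\setminus\{0\}$ there exists $1\le j\le r^2$ with $E\in\operatorname{int}B_j^\Gamma$. (ii) If $\mathfrak p=(p,q)$ with $p$ odd and $q$ divisible by four, then $0\in\operatorname{int}B_j^{\Gamma_{\mathfrak p}}$ for some $1\le j\le pq$.
   Context: For $r\ge3$ and $\theta\in\mathbb R$, $\Delta_\theta^r\in\mathbb C^{r\times r}$ is the Hermitian matrix with $1$ on the sub- and superdiagonals, $0$ on the diagonal, entry $e^{-i\theta}$ in position $(1,r)$ and $e^{i\theta}$ in position $(r,1)$, all other entries $0$; $\Delta_\theta^1=2\cos\theta$, $\Delta_\theta^2=\begin{bmatrix}0&1+e^{-i\theta}\\1+e^{i\theta}&0\end{bmatrix}$. For $\mathfrak p=(p,q)$, $\Gamma_{\mathfrak p}=([0,p)\times[0,q))\cap\mathbb Z^2$ and $\Delta^{\Gamma_{\mathfrak p}}_{\theta,\varphi}=\Delta_\theta^p\otimes I_q+I_p\otimes\Delta_\varphi^q$ (the discrete Laplacian on $\mathbb Z^2$ restricted to Floquet–Bloch functions with $\psi_{n+p,m}=e^{i\theta}\psi_{n,m}$, $\psi_{n,m+q}=e^{i\varphi}\psi_{n,m}$). Its eigenvalues counted with multiplicity are $\lambda_1^\Gamma(\theta,\varphi)\le\cdots\le\lambda_{pq}^\Gamma(\theta,\varphi)$, and the $j$th band is $B_j^\Gamma=\{\lambda_j^\Gamma(\theta,\varphi):(\theta,\varphi)\in[0,\pi]^2\}$.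 $\operatorname{int}$ denotes interior in $\mathbb R$. *)

theory Defs
  imports "HOL-Analysis.Elementary_Topology" "Jordan_Normal_Form.Char_Poly"
begin

definition Delta :: "nat \<Rightarrow> real \<Rightarrow> complex mat" where
  "Delta r \<theta> =
    (if r = 1 then mat 1 1 (\<lambda>_. complex_of_real (2 * cos \<theta>))
     else if r = 2 then mat 2 2 (\<lambda>(i,j).
        if i = 0 \<and> j = 1 then 1 + cis (-\<theta>)
        else if i = 1 \<and> j = 0 then 1 + cis \<theta> else 0)
     else mat r r (\<lambda>(i,j).
        if i + 1 = j \<or> j + 1 = i then 1
        else if i = 0 \<and> j = r - 1 then cis (-\<theta>)
        else if i = r - 1 \<and> j = 0 then cis \<theta>
        else 0))"

definition kron :: "complex mat \<Rightarrow> complex mat \<Rightarrow> complex mat" where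
  "kron A B = mat (dim_row A * dim_row B) (dim_col A * dim_col B)
     (\<lambda>(i,j). A $$ (i div dim_row B, j div dim_col B) * B $$ (i mod dim_row B, j mod dim_col B))"

definition DeltaGamma :: "nat \<Rightarrow> nat \<Rightarrow> real \<Rightarrow> real \<Rightarrow> complex mat" where
  "DeltaGamma p q \<theta> \<phi> = kron (Delta p \<theta>) (1\<^sub>m q) + kron (1\<^sub>m p) (Delta q \<phi>)"

definition eigs :: "complex mat \<Rightarrow> real list" where
  "eigs A = (THE xs. sorted xs \<and>
      char_poly A = prod_list (map (\<lambda>x. [: - complex_of_real x, 1 :]) xs))"

definition lam :: "nat \<Rightarrow> nat \<Rightarrow> nat \<Rightarrow> real \<Rightarrow> real \<Rightarrow> real" where
  "lam p q j \<theta> \<phi> = eigs (DeltaGamma p q \<theta> \<phi>) ! (j - 1)"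

definition band :: "nat \<Rightarrow> nat \<Rightarrow> nat \<Rightarrow> real set" where
  "band p q j = {lam p q j \<theta> \<phi> | \<theta> \<phi>. \<theta> \<in> {0..pi} \<and> \<phi> \<in> {0..pi}}"

end

theory Submission
  imports Defs "HOL-Library.Periodic_Fun"
begin

text \<open>
  The discrete Fourier basis diagonalises the matrix, with eigenvalues
  \<open>2 cos ((\<theta> + 2\<pi>k)/p) + 2 cos ((\<phi> + 2\<pi>l)/q)\<close>. As the ordered eigenvalues are continuous, \<open>E\<close> is interior to
  some band as soon as the number of eigenvalues \<open>\<le> E\<close> at one pair of angles is smaller than the number
  of eigenvalues \<open>< E\<close> at another. Such pairs are found by perturbing a point with eigenvalue \<open>E\<close>.

  For \<open>E > 0\<close> start at \<open>\<phi> = 0\<close> with \<open>E = 2 cos (\<theta>/p) + 2\<close> and let \<open>M\<close> be the set of indices whose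
  eigenvalue equals \<open>E\<close>. Increasing \<open>\<phi>\<close> pushes more than half of \<open>M\<close> below \<open>E\<close>, whereas a generic direction or
  its opposite pushes at most half of it below. Shifting both momenta by \<open>\<pi>\<close> changes the sign of all
  eigenvalues and settles \<open>E < 0\<close>. For \<open>E = 0\<close> start at \<open>\<theta> = \<phi> = 0\<close>: the eigenvalues equal to \<open>0\<close> come in pairs
  that cancel, except for one saddle point, which moves down with \<open>\<theta>\<close> and up with \<open>\<phi>\<close>.
\<close>

section \<open>Diagonalisation\<close>

lemma Delta_carrier [simp]: "Delta r \<theta> \<in> carrier_mat r r"
  by (auto simp: Delta_def)

text \<open>For small \<open>r\<close> the positions of the hopping and corner entries coincide.
  Adding the indicators, rather than taking cases, then yields exactly the special matrices: the two
  phases sum to \<open>2 * cos \<theta>\<close> for \<open>r = 1\<close>, and \<open>1\<close> meets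
  a phase for \<open>r = 2\<close>.\<close>

lemma Delta_index:
  assumes "i < r" "j < r"
  shows "Delta r \<theta> $$ (i, j) =
    (if j = Suc i then 1 else 0) + (if i = Suc j then 1 else 0)
    + (if i = 0 \<and> j = r - 1 then cis (- \<theta>) else 0) + (if i = r - 1 \<and> j = 0 then cis \<theta> else 0)"
proof -
  consider "r = 1" | "r = 2" | "r > 2" using assms by linarith
  then show ?thesis
  proof cases
    case 1
    then show ?thesis using assms by (simp add: Delta_def complex_eq_iff)
  next
    case 2
    then show ?thesis using assms by (auto simp: Delta_def less_2_cases_iff)
  next
    case 3
    then show ?thesis using assms by (auto simp: Delta_def)
  qed
qed

lemma Delta_sum:
  assumes "n < r"
  shows "(\<Sum>m<r. Delta r \<theta> $$ (n, m) * v m) =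
    (if Suc n < r then v (Suc n) else cis \<theta> * v 0) + (if n = 0 then cis (- \<theta>) * v (r - 1) else v (n - 1))"
proof -
  \<comment> \<open>Each indicator is put in the form \<open>m = const\<close>, so that the sum
    collapses termwise. The inner test \<open>n = 0\<close> guards against the truncated difference
    \<open>n - 1\<close>.\<close>
  have "(\<Sum>m<r. Delta r \<theta> $$ (n, m) * v m) =
    (\<Sum>m<r. (if m = Suc n then v m else 0) + (if m = n - 1 then if n = 0 then 0 else v m else 0)
    + (if m = r - 1 then if n = 0 then cis (- \<theta>) * v m else 0 else 0)
    + (if m = 0 then if n = r - 1 then cis \<theta> * v m else 0 else 0))"
    using assms by (intro sum.cong refl) (auto simp: Delta_index algebra_simps)
  also have "\<dots> = (if Suc n < r then v (Suc n) else cis \<theta> * v 0) + (if n = 0 then cis (- \<theta>) * v (r - 1) else v (n - 1))"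
    using assms by (auto simp: sum.distrib)
  finally show ?thesis .
qed

text \<open>The momenta \<open>x\<close> with \<open>cis (r * x) = cis \<theta>\<close>, which are
  those of the plane waves satisfying the Floquet condition.\<close>

definition angle :: "nat \<Rightarrow> real \<Rightarrow> nat \<Rightarrow> real" where
  "angle r \<theta> k = (\<theta> + 2 * pi * real k) / real r"

definition fourier :: "nat \<Rightarrow> real \<Rightarrow> complex mat" where
  "fourier r \<theta> = mat r r (\<lambda>(n, k). cis (real n * angle r \<theta> k))"

definition fourier_inv :: "nat \<Rightarrow> real \<Rightarrow> complex mat" where
  "fourier_inv r \<theta> = mat r r (\<lambda>(k, n). cis (- real n * angle r \<theta> k) / of_nat r)"

lemma fourier_carrier [simp]: "fourier r \<theta> \<in> carrier_mat r r" "fourier_inv r \<theta> \<in> carrier_mat r r"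
  by (auto simp: fourier_def fourier_inv_def)

lemma cis_angle:
  assumes "r > 0"
  shows "cis (real r * angle r \<theta> k) = cis \<theta>"
proof -
  have "real r * angle r \<theta> k = \<theta> + 2 * pi * real k"
    using assms by (simp add: angle_def)
  then show ?thesis
    by (simp flip: cis_mult)
qed

text \<open>Moving one site along the plane wave multiplies it by \<open>cis x\<close> or
  \<open>cis (- x)\<close>, and these add up to \<open>2 * cos x\<close>. At the two ends the corner
  phases continue the wave correctly by \<open>cis_angle\<close>.\<close>

lemma Delta_fourier:
  assumes "n < r" "k < r"
  shows "(Delta r \<theta> * fourier r \<theta>) $$ (n, k) = fourier r \<theta> $$ (n, k) * complex_of_real (2 * cos (angle r \<theta> k))"
proof -
  let ?x = "angle r \<theta> k"
  let ?v = "\<lambda>m. cis (real m * ?x)"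
  have cos: "complex_of_real (2 * cos ?x) = cis ?x + cis (- ?x)"
    by (simp add: complex_eq_iff)
  have up: "(if Suc n < r then ?v (Suc n) else cis \<theta> * ?v 0) = ?v n * cis ?x"
  proof (cases "Suc n < r")
    case False
    then have "r = Suc n" using assms by simp
    then show ?thesis using cis_angle[of r \<theta> k] by (simp add: cis_mult algebra_simps)
  qed (simp add: cis_mult algebra_simps)
  have down: "(if n = 0 then cis (- \<theta>) * ?v (r - 1) else ?v (n - 1)) = ?v n * cis (- ?x)"
  proof (cases "n = 0")
    case True
    have "?v (r - 1) = cis (real r * ?x) * cis (- ?x)"
      using assms by (simp add: cis_mult of_nat_diff algebra_simps)
    then show ?thesis using True assms by (simp add: cis_angle cis_mult)
  next
    case False
    then show ?thesis by (simp add: cis_mult of_nat_diff algebra_simps)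
  qed
  have "(Delta r \<theta> * fourier r \<theta>) $$ (n, k) = (\<Sum>m<r. Delta r \<theta> $$ (n, m) * ?v m)"
    using assms carrier_matD[OF Delta_carrier[of r \<theta>]]
    by (simp add: fourier_def scalar_prod_def atLeast0LessThan)
  then show ?thesis
    unfolding Delta_sum[OF assms(1)] up down cos using assms by (simp add: fourier_def distrib_left)
qed

text \<open>Orthogonality of characters: the phase \<open>\<theta>\<close> cancels, and each entry
  is a geometric sum over powers of an \<open>r\<close>-th root of unity.\<close>

lemma fourier_inv_mult: "fourier_inv r \<theta> * fourier r \<theta> = 1\<^sub>m r"
proof (rule eq_matI)
  fix i j assume "i < dim_row (1\<^sub>m r :: complex mat)" "j < dim_col (1\<^sub>m r :: complex mat)"
  then have ij: "i < r" "j < r" by auto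
  let ?w = "cis (2 * pi * (real j - real i) / real r)"
  have diff: "angle r \<theta> j - angle r \<theta> i = 2 * pi * (real j - real i) / real r"
    by (simp add: angle_def diff_divide_distrib[symmetric] algebra_simps)
  have "(fourier_inv r \<theta> * fourier r \<theta>) $$ (i, j)
      = (\<Sum>n<r. cis (- real n * angle r \<theta> i) / of_nat r * cis (real n * angle r \<theta> j))"
    using ij by (simp add: fourier_def fourier_inv_def scalar_prod_def atLeast0LessThan)
  also have "\<dots> = (\<Sum>n<r. ?w ^ n / of_nat r)"
    unfolding diff[symmetric] by (intro sum.cong refl) (simp add: cis_mult Complex.DeMoivre algebra_simps)
  also have "\<dots> = (if i = j then 1 else 0)"
  proof (cases "i = j")
    case False
    \<comment> \<open>Otherwise \<open>r\<close> would divide \<open>j - i\<close>, which is nonzero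
      and smaller than \<open>r\<close> in absolute value.\<close>
    have "?w \<noteq> 1"
    proof
      assume "?w = 1"
      then have "cos (2 * pi * (real j - real i) / real r) = 1"
        by (metis cis.sel(1) one_complex.sel(1))
      then obtain m :: int where "2 * pi * (real j - real i) / real r = of_int m * 2 * pi"
        unfolding cos_one_2pi_int by blast
      then have "(2 * pi) * (real j - real i) = (2 * pi) * (of_int m * real r)"
        using ij by (simp add: field_simps)
      then have "real j - real i = of_int m * real r"
        by (simp only: mult_cancel_left) simp
      then have "of_int (int j - int i) = (of_int (m * int r) :: real)"
        by simp
      then have "int j - int i = m * int r"
        by (simp only: of_int_eq_iff)
      moreover have "\<bar>int j - int i\<bar> < int r" using ij by auto
      ultimately have "m = 0"
        by (metis abs_mult abs_of_nat dvd_imp_le_int dvd_triv_right int_dvd_int_iff mult_eq_0_iff not_less zdvd_not_zless zero_less_abs_iff dvd_abs_iff)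
      then show False using \<open>int j - int i = m * int r\<close> False by simp
    qed
    moreover have "?w ^ r = 1"
    proof -
      have "?w ^ r = cis (2 * pi * (real j - real i))"
        using ij by (simp add: Complex.DeMoivre)
      also have "\<dots> = 1" by (intro cis_multiple_2pi) auto
      finally show ?thesis .
    qed
    ultimately have "(\<Sum>n<r. ?w ^ n) = 0"
      by (simp add: geometric_sum)
    then show ?thesis
      using False by (simp flip: sum_divide_distrib)
  qed (use ij in simp)
  finally show "(fourier_inv r \<theta> * fourier r \<theta>) $$ (i, j) = 1\<^sub>m r $$ (i, j)"
    using ij by simp
qed (auto simp: fourier_def fourier_inv_def)

section \<open>Kronecker products\<close>

lemma kron_carrier [simp]:
  "A \<in> carrier_mat n n \<Longrightarrow> B \<in> carrier_mat m m \<Longrightarrow> kron A B \<in> carrier_mat (n * m) (n * m)"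
  by (auto simp: kron_def)

lemma kron_index:
  assumes "A \<in> carrier_mat n n" "B \<in> carrier_mat m m" "i < n * m" "j < n * m"
  shows "kron A B $$ (i, j) = A $$ (i div m, j div m) * B $$ (i mod m, j mod m)"
  using assms by (auto simp: kron_def)

lemma mult_add_less_mult:
  fixes k l m n :: nat
  assumes "k < n" "l < m"
  shows "k * m + l < n * m"
proof -
  have "k * m + l < Suc k * m" using assms by simp
  also have "\<dots> \<le> n * m" using assms by (intro mult_le_mono1) simp
  finally show ?thesis .
qed

lemma sum_div_mod:
  fixes n m :: nat
  assumes "m > 0"
  shows "(\<Sum>t<n * m. f (t div m) (t mod m)) = (\<Sum>k<n. \<Sum>l<m. f k l)"
  unfolding sum.cartesian_product
  by (rule sum.reindex_bij_witness[where i = "\<lambda>(k, l). k * m + l" and j = "\<lambda>t. (t div m, t mod m)"])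
    (use assms in \<open>auto simp: less_mult_imp_div_less mult_add_less_mult\<close>)

text \<open>The mixed-product rule: writing the summation index as \<open>t = k * m + l\<close>
  factors the sum into one over \<open>k\<close> and one over \<open>l\<close>.\<close>

lemma kron_mult:
  assumes A: "A \<in> carrier_mat n n" and B: "B \<in> carrier_mat m m"
    and C: "C \<in> carrier_mat n n" and D: "D \<in> carrier_mat m m" and m: "m > 0"
  shows "kron A B * kron C D = kron (A * C) (B * D)"
proof (rule eq_matI)
  have AC: "A * C \<in> carrier_mat n n" and BD: "B * D \<in> carrier_mat m m"
    using A B C D by auto
  note dims = carrier_matD[OF kron_carrier[OF A B]] carrier_matD[OF kron_carrier[OF C D]]
    carrier_matD[OF kron_carrier[OF AC BD]]
  show "dim_row (kron A B * kron C D) = dim_row (kron (A * C) (B * D))"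
    "dim_col (kron A B * kron C D) = dim_col (kron (A * C) (B * D))"
    using dims by auto
  fix i j assume "i < dim_row (kron (A * C) (B * D))" "j < dim_col (kron (A * C) (B * D))"
  then have ij: "i < n * m" "j < n * m" using dims by auto
  then have div: "i div m < n" "j div m < n" "i mod m < m" "j mod m < m"
    using m by (auto simp: less_mult_imp_div_less)
  have "(kron A B * kron C D) $$ (i, j) = (\<Sum>t<n * m. kron A B $$ (i, t) * kron C D $$ (t, j))"
    using ij dims by (simp add: scalar_prod_def atLeast0LessThan)
  also have "\<dots> = (\<Sum>t<n * m. (A $$ (i div m, t div m) * C $$ (t div m, j div m))
                            * (B $$ (i mod m, t mod m) * D $$ (t mod m, j mod m)))"
    using ij by (intro sum.cong refl) (simp add: kron_index[OF A B] kron_index[OF C D])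
  also have "\<dots> = (\<Sum>k<n. A $$ (i div m, k) * C $$ (k, j div m)) * (\<Sum>l<m. B $$ (i mod m, l) * D $$ (l, j mod m))"
    by (simp add: sum_div_mod[OF m, where f = "\<lambda>k l. (A $$ (i div m, k) * C $$ (k, j div m))
                            * (B $$ (i mod m, l) * D $$ (l, j mod m))"] sum_product)
  also have "\<dots> = kron (A * C) (B * D) $$ (i, j)"
    using A B C D div ij by (simp add: kron_index[OF AC BD] scalar_prod_def atLeast0LessThan)
  finally show "(kron A B * kron C D) $$ (i, j) = kron (A * C) (B * D) $$ (i, j)" .
qed

lemma kron_one: "m > 0 \<Longrightarrow> kron (1\<^sub>m n) (1\<^sub>m m) = 1\<^sub>m (n * m)"
  by (rule eq_matI) (auto simp: kron_def less_mult_imp_div_less, metis div_mult_mod_eq)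


section \<open>Spectrum of the two-dimensional operator\<close>

definition energy :: "nat \<Rightarrow> nat \<Rightarrow> real \<Rightarrow> real \<Rightarrow> nat \<times> nat \<Rightarrow> real" where
  "energy p q \<theta> \<phi> = (\<lambda>(k,l). 2 * cos ((\<theta> + 2 * pi * real k) / real p)
                            + 2 * cos ((\<phi> + 2 * pi * real l) / real q))"

definition idx :: "nat \<Rightarrow> nat \<Rightarrow> (nat \<times> nat) set" where
  "idx p q = {..<p} \<times> {..<q}"

text \<open>The Kronecker product of the two Fourier matrices diagonalises both summands at once.
  The operator is therefore similar to a diagonal matrix whose \<open>i\<close>-th entry belongs to
  the momentum pair \<open>(i div q, i mod q)\<close>.\<close>

lemma char_poly_DeltaGamma:
  assumes q: "q > 0"
  shows "char_poly (DeltaGamma p q \<theta> \<phi>)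
    = (\<Prod>x\<leftarrow>map (\<lambda>i. energy p q \<theta> \<phi> (i div q, i mod q)) [0..<p * q]. [:- complex_of_real x, 1:])"
proof -
  let ?n = "p * q"
  let ?e = "\<lambda>i. energy p q \<theta> \<phi> (i div q, i mod q)"
  let ?P = "kron (fourier p \<theta>) (fourier q \<phi>)"
  let ?Q = "kron (fourier_inv p \<theta>) (fourier_inv q \<phi>)"
  let ?D = "mat ?n ?n (\<lambda>(i, j). if i = j then complex_of_real (?e j) else 0)"
  let ?A = "DeltaGamma p q \<theta> \<phi>"
  have P: "?P \<in> carrier_mat ?n ?n" and Q: "?Q \<in> carrier_mat ?n ?n" and D: "?D \<in> carrier_mat ?n ?n"
    and A: "?A \<in> carrier_mat ?n ?n"
    by (auto simp: DeltaGamma_def)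
  have DF: "Delta p \<theta> * fourier p \<theta> \<in> carrier_mat p p" "Delta q \<phi> * fourier q \<phi> \<in> carrier_mat q q"
    by (rule mult_carrier_mat[OF Delta_carrier fourier_carrier(1)])+
  have QP: "?Q * ?P = 1\<^sub>m ?n"
    using q by (simp add: kron_mult[of _ p _ q] fourier_inv_mult kron_one)
  then have PQ: "?P * ?Q = 1\<^sub>m ?n"
    using mat_mult_left_right_inverse[OF Q P] by simp
  have "?A * ?P = kron (Delta p \<theta>) (1\<^sub>m q) * ?P + kron (1\<^sub>m p) (Delta q \<phi>) * ?P"
    unfolding DeltaGamma_def by (rule add_mult_distrib_mat[OF kron_carrier[OF Delta_carrier one_carrier_mat]
          kron_carrier[OF one_carrier_mat Delta_carrier] P])
  also have "\<dots> = kron (Delta p \<theta> * fourier p \<theta>) (fourier q \<phi>) + kron (fourier p \<theta>) (Delta q \<phi> * fourier q \<phi>)"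
    using q by (simp add: kron_mult[of _ p _ q] left_mult_one_mat[OF fourier_carrier(1)])
  also have "\<dots> = ?P * ?D"
  proof (rule eq_matI)
    fix i j assume "i < dim_row (?P * ?D)" "j < dim_col (?P * ?D)"
    then have ij: "i < ?n" "j < ?n" using P by auto
    then have div: "i div q < p" "j div q < p" "i mod q < q" "j mod q < q"
      using q by (auto simp: less_mult_imp_div_less)
    have "(?P * ?D) $$ (i, j) = (\<Sum>t<?n. ?P $$ (i, t) * (if t = j then complex_of_real (?e j) else 0))"
      using ij carrier_matD[OF P] by (simp add: scalar_prod_def atLeast0LessThan)
    also have "\<dots> = ?P $$ (i, j) * complex_of_real (?e j)"
      using ij by (simp add: if_distrib cong: if_cong)
    finally show "(kron (Delta p \<theta> * fourier p \<theta>) (fourier q \<phi>) + kron (fourier p \<theta>) (Delta q \<phi> * fourier q \<phi>)) $$ (i, j)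
        = (?P * ?D) $$ (i, j)"
      using ij div DF carrier_matD[OF kron_carrier[OF fourier_carrier(1) DF(2)]]
      by (simp add: kron_index[of _ p _ q] Delta_fourier energy_def angle_def algebra_simps del: index_mult_mat(1))
  qed (use carrier_matD[OF P] carrier_matD[OF kron_carrier[OF fourier_carrier(1) DF(2)]] in simp_all)
  finally have AP: "?A * ?P = ?P * ?D" .
  have "?A = ?A * (?P * ?Q)"
    using A PQ by simp
  also have "\<dots> = ?P * ?D * ?Q"
    using AP A P Q by (simp flip: assoc_mult_mat[of _ ?n ?n _ ?n _ ?n])
  finally have "?A = ?P * ?D * ?Q" .
  then have "similar_mat ?A ?D"
    by (rule similar_matI[OF _ PQ QP, rotated]) (use A P Q D in \<open>simp only: insert_subset empty_subsetI simp_thms\<close>)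
  then have "char_poly ?A = char_poly ?D"
    by (rule char_poly_similar)
  also have "\<dots> = (\<Prod>a\<leftarrow>diag_mat ?D. [:- a, 1:])"
    by (rule char_poly_upper_triangular[OF D]) (auto simp: upper_triangular_def)
  also have "diag_mat ?D = map (\<lambda>i. complex_of_real (?e i)) [0..<?n]"
    by (auto simp: diag_mat_def)
  finally show ?thesis
    by (simp add: o_def)
qed

text \<open>The definite description in \<open>eigs\<close> needs uniqueness: the polynomial
  determines the multiset of its roots, \<open>complex_of_real\<close> is injective, and a multiset
  has only one sorted listing.\<close>

lemma eigs_eqI:
  assumes "sorted xs" and char: "char_poly A = (\<Prod>x\<leftarrow>xs. [:- complex_of_real x, 1:])"
  shows "eigs A = xs"
  unfolding eigs_def
proof (rule the_equality)
  fix ys assume ys: "sorted ys \<and> char_poly A = (\<Prod>x\<leftarrow>ys. [:- complex_of_real x, 1:])"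
  have proots: "proots (\<Prod>x\<leftarrow>zs. [:- complex_of_real x, 1:]) = image_mset complex_of_real (mset zs)" for zs
  proof (induction zs)
    case (Cons z zs)
    have "(\<Prod>x\<leftarrow>zs. [:- complex_of_real x, 1:]) \<noteq> 0"
      by (auto simp: prod_list_zero_iff)
    then show ?case
      using Cons by (simp add: proots_mult del: mult_pCons_left mult_pCons_right)
  qed simp
  have "image_mset complex_of_real (mset ys) = image_mset complex_of_real (mset xs)"
    using ys char proots by metis
  then have "mset ys = mset xs"
    using multiset.inj_map_strong[of "mset ys" "mset xs" complex_of_real complex_of_real] by auto
  then show "ys = xs"
    using assms(1) ys by (metis properties_for_sort)
qed (use assms in auto)

lemma eigs_DeltaGamma:
  assumes "q > 0"
  shows "sorted (eigs (DeltaGamma p q \<theta> \<phi>))"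
    and "mset (eigs (DeltaGamma p q \<theta> \<phi>)) = image_mset (energy p q \<theta> \<phi>) (mset_set (idx p q))"
proof -
  let ?es = "map (\<lambda>i. energy p q \<theta> \<phi> (i div q, i mod q)) [0..<p * q]"
  have "(\<Prod>x\<leftarrow>sort ?es. [:- complex_of_real x, 1:]) = (\<Prod>x\<leftarrow>?es. [:- complex_of_real x, 1:])"
    by (simp only: mset_map mset_sort flip: prod_mset_prod_list)
  then have eigs: "eigs (DeltaGamma p q \<theta> \<phi>) = sort ?es"
    by (intro eigs_eqI) (simp_all only: char_poly_DeltaGamma[OF assms] sorted_sort)
  show "sorted (eigs (DeltaGamma p q \<theta> \<phi>))"
    unfolding eigs by (rule sorted_sort)
  have "bij_betw (\<lambda>i. (i div q, i mod q)) {0..<p * q} (idx p q)"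
    by (rule bij_betw_byWitness[where f' = "\<lambda>(k, l). k * q + l"])
      (use assms in \<open>auto simp: idx_def less_mult_imp_div_less mult_add_less_mult\<close>)
  then have "mset_set (idx p q) = image_mset (\<lambda>i. (i div q, i mod q)) (mset_set {0..<p * q})"
    by (simp add: bij_betw_def image_mset_mset_set)
  then show "mset (eigs (DeltaGamma p q \<theta> \<phi>)) = image_mset (energy p q \<theta> \<phi>) (mset_set (idx p q))"
    by (simp add: eigs multiset.map_comp o_def flip: mset_upt)
qed

section \<open>Bands and eigenvalue counts\<close>

lemma finite_idx [simp]: "finite (idx p q)"
  by (simp add: idx_def)

lemma card_idx [simp]: "card (idx p q) = p * q"
  by (simp add: idx_def card_cartesian_product)

text \<open>The entries satisfying a downward closed predicate form a prefix of the sorted list, and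
  the cardinality is its length. A general \<open>P\<close> serves both \<open><\<close> and
  \<open>\<le>\<close>.\<close>

lemma sorted_nth_iff_card:
  fixes xs :: "'a::linorder list"
  assumes sorted: "sorted xs" and mset: "mset xs = image_mset f (mset_set I)"
    and fin: "finite I" and j: "j < length xs"
    and down: "\<And>x y. x \<le> y \<Longrightarrow> P y \<Longrightarrow> P x"
  shows "P (xs ! j) \<longleftrightarrow> j < card {i \<in> I. P (f i)}"
proof -
  let ?K = "{k. k < length xs \<and> P (xs ! k)}"
  have "card {i \<in> I. P (f i)} = size (filter_mset P (image_mset f (mset_set I)))"
    using fin by (simp add: filter_mset_image_mset)
  also have "\<dots> = length (filter P xs)"
    by (simp flip: mset mset_filter)
  finally have card: "card {i \<in> I. P (f i)} = card ?K"
    by (simp add: length_filter_conv_card)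
  show ?thesis
  proof
    assume P: "P (xs ! j)"
    have "{..j} \<subseteq> ?K"
      using P j down sorted by (auto intro: down sorted_nth_mono)
    then have "card {..j} \<le> card ?K"
      by (intro card_mono) auto
    then show "j < card {i \<in> I. P (f i)}"
      by (simp add: card)
  next
    assume less: "j < card {i \<in> I. P (f i)}"
    show "P (xs ! j)"
    proof (rule ccontr)
      assume notP: "\<not> P (xs ! j)"
      have "?K \<subseteq> {..<j}"
        using notP down sorted_nth_mono[OF sorted] by (metis (mono_tags, lifting) lessThan_iff mem_Collect_eq not_le subsetI)
      then have "card ?K \<le> card {..<j}"
        by (intro card_mono) auto
      then show False
        using less card by simp
    qed
  qed
qed

text \<open>Bands are numbered from one and list positions from zero, so the strict bound on
  \<open>j - 1\<close> becomes \<open>j \<le> card\<close>.\<close>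

lemma lam_iff_card:
  assumes "p > 0" "q > 0" "j \<in> {1..p * q}" "\<And>x y. x \<le> y \<Longrightarrow> P y \<Longrightarrow> P x"
  shows "P (lam p q j \<theta> \<phi>) \<longleftrightarrow> j \<le> card {i \<in> idx p q. P (energy p q \<theta> \<phi> i)}"
proof -
  note e = eigs_DeltaGamma[OF assms(2), of p \<theta> \<phi>]
  have "length (eigs (DeltaGamma p q \<theta> \<phi>)) = p * q"
    using arg_cong[OF e(2), of size] by simp
  then have "j - 1 < length (eigs (DeltaGamma p q \<theta> \<phi>))"
    using assms(3) by auto
  from sorted_nth_iff_card[OF e finite_idx this, of P] show ?thesis
    using assms(3,4) by (auto simp: lam_def)
qed

lemma lam_less_iff:
  assumes "p > 0" "q > 0" "j \<in> {1..p * q}"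
  shows "lam p q j \<theta> \<phi> < c \<longleftrightarrow> j \<le> card {i \<in> idx p q. energy p q \<theta> \<phi> i < c}"
  by (rule lam_iff_card[OF assms]) auto

lemma lam_le_iff:
  assumes "p > 0" "q > 0" "j \<in> {1..p * q}"
  shows "lam p q j \<theta> \<phi> \<le> c \<longleftrightarrow> j \<le> card {i \<in> idx p q. energy p q \<theta> \<phi> i \<le> c}"
  by (rule lam_iff_card[OF assms]) auto

text \<open>Continuity is read off from counts. Each of the finitely many energies strictly above
  \<open>a\<close> stays so nearby, hence the number of energies at most \<open>a\<close> cannot
  grow and the ordered eigenvalue stays above \<open>a\<close>. Upper bounds are dual.\<close>

lemma continuous_on_lam:
  assumes pq: "p > 0" "q > 0" "j \<in> {1..p * q}"
  shows "continuous_on UNIV (\<lambda>s. lam p q j (fst s) (snd s))"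
proof -
  let ?e = "\<lambda>s. energy p q (fst s) (snd s)"
  have e: "((\<lambda>s. ?e s i) \<longlongrightarrow> ?e s0 i) (at s0)" for s0 i
    unfolding energy_def using pq by (cases i) (auto intro!: tendsto_intros)
  have "((\<lambda>s. lam p q j (fst s) (snd s)) \<longlongrightarrow> lam p q j (fst s0) (snd s0)) (at s0)" for s0
  proof (rule order_tendstoI)
    fix a assume "a < lam p q j (fst s0) (snd s0)"
    then have *: "card {i \<in> idx p q. ?e s0 i \<le> a} < j"
      using lam_le_iff[OF pq, of "fst s0" "snd s0" a] by simp
    have "\<forall>\<^sub>F s in at s0. \<forall>i \<in> {i \<in> idx p q. a < ?e s0 i}. a < ?e s i"
      by (intro eventually_ball_finite ballI order_tendstoD(1)[OF e]) auto
    then show "\<forall>\<^sub>F s in at s0. a < lam p q j (fst s) (snd s)"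
    proof eventually_elim
      case (elim s)
      have "card {i \<in> idx p q. ?e s i \<le> a} \<le> card {i \<in> idx p q. ?e s0 i \<le> a}"
        using elim by (intro card_mono) (auto simp: not_less[symmetric])
      then have "\<not> lam p q j (fst s) (snd s) \<le> a"
        using * lam_le_iff[OF pq, of "fst s" "snd s" a] by simp
      then show ?case by simp
    qed
  next
    fix a assume "lam p q j (fst s0) (snd s0) < a"
    then have *: "j \<le> card {i \<in> idx p q. ?e s0 i < a}"
      using lam_less_iff[OF pq, of "fst s0" "snd s0" a] by simp
    have "\<forall>\<^sub>F s in at s0. \<forall>i \<in> {i \<in> idx p q. ?e s0 i < a}. ?e s i < a"
      by (intro eventually_ball_finite ballI order_tendstoD(2)[OF e]) auto
    then show "\<forall>\<^sub>F s in at s0. lam p q j (fst s) (snd s) < a"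
    proof eventually_elim
      case (elim s)
      have "card {i \<in> idx p q. ?e s0 i < a} \<le> card {i \<in> idx p q. ?e s i < a}"
        using elim by (intro card_mono) auto
      then show ?case
        using * lam_less_iff[OF pq, of "fst s" "snd s" a] by simp
    qed
  qed
  then show ?thesis
    by (simp add: continuous_on_def)
qed

section \<open>Invariance of the spectrum under angles with equal cosine\<close>

lemma image_mset_cos_shift:
  assumes "p > 0"
  shows "image_mset (\<lambda>k. cos ((\<theta> + 2 * pi + 2 * pi * real k) / real p)) (mset_set {..<p})
       = image_mset (\<lambda>k. cos ((\<theta> + 2 * pi * real k) / real p)) (mset_set {..<p})"
proof -
  let ?c = "\<lambda>k. cos ((\<theta> + 2 * pi * real k) / real p)"
  have "(\<theta> + 2 * pi * real p) / real p = \<theta> / real p + 2 * pi"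
    using assms by (simp add: field_simps)
  then have wrap: "?c p = ?c 0"
    by simp
  \<comment> \<open>Raising \<open>\<theta>\<close> by a full turn replaces the index
    \<open>k\<close> by \<open>k + 1\<close>; only the last index leaves the range, and it wraps
    around to \<open>0\<close>.\<close>
  have "image_mset ?c (image_mset Suc (mset_set {..<p})) = image_mset ?c (mset_set {..<p})"
  proof -
    have range: "Suc ` {..<p} = insert p {1..<p}"
      using assms by (auto simp: image_Suc_lessThan)
    have "image_mset Suc (mset_set {..<p}) = mset_set (insert p {1..<p})"
      using range by (simp add: image_mset_mset_set)
    moreover have "{..<p} = insert 0 {1..<p}" using assms by auto
    ultimately show ?thesis using wrap by simp
  qed
  then show ?thesis
    by (simp add: multiset.map_comp o_def algebra_simps)
qed

lemma image_mset_cos_minus: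
  assumes "p > 0"
  shows "image_mset (\<lambda>k. cos ((- \<theta> + 2 * pi * real k) / real p)) (mset_set {..<p})
       = image_mset (\<lambda>k. cos ((\<theta> + 2 * pi * real k) / real p)) (mset_set {..<p})"
proof -
  have "image_mset (\<lambda>k. cos ((\<theta> + 2 * pi + 2 * pi * real k) / real p)) (mset_set {..<p})
      = image_mset (\<lambda>k. cos ((- \<theta> + 2 * pi * real k) / real p)) (image_mset (\<lambda>k. p - 1 - k) (mset_set {..<p}))"
    unfolding multiset.map_comp
  proof (rule image_mset_cong)
    fix k assume "k \<in># mset_set {..<p}"
    then have k: "k < p" by simp
    \<comment> \<open>Reversing the indices reflects the momentum about \<open>pi\<close>; starting
      from \<open>\<theta> + 2 * pi\<close> makes the reversed indices run from \<open>0\<close> to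
      \<open>p - 1\<close>.\<close>
    have "(- \<theta> + 2 * pi * real (p - 1 - k)) / real p = 2 * pi - (\<theta> + 2 * pi + 2 * pi * real k) / real p"
      using k by (simp add: of_nat_diff field_simps)
    then show "cos ((\<theta> + 2 * pi + 2 * pi * real k) / real p)
      = ((\<lambda>k. cos ((- \<theta> + 2 * pi * real k) / real p)) \<circ> (\<lambda>k. p - 1 - k)) k"
      by simp
  qed
  also have "image_mset (\<lambda>k. p - 1 - k) (mset_set {..<p}) = mset_set {..<p}"
  proof (subst image_mset_mset_set)
    show "inj_on (\<lambda>k. p - 1 - k) {..<p}" by (auto intro!: inj_onI)
    have "(\<lambda>k. p - 1 - k) ` {..<p} = {..<p}"
    proof (rule endo_inj_surj)
      show "inj_on (\<lambda>k. p - 1 - k) {..<p}" by (auto intro!: inj_onI)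
    qed (use assms in auto)
    then show "mset_set ((\<lambda>k. p - 1 - k) ` {..<p}) = mset_set {..<p}" by simp
  qed
  finally show ?thesis
    using image_mset_cos_shift[OF assms] by simp
qed

text \<open>Angles with equal cosine differ by a sign and full turns, so both sides reduce to the
  representative \<open>arccos (cos t)\<close>.\<close>

lemma image_mset_cos_cong:
  assumes "p > 0" "cos \<theta> = cos \<theta>'"
  shows "image_mset (\<lambda>k. cos ((\<theta> + 2 * pi * real k) / real p)) (mset_set {..<p})
       = image_mset (\<lambda>k. cos ((\<theta>' + 2 * pi * real k) / real p)) (mset_set {..<p})"
proof -
  let ?M = "\<lambda>t. image_mset (\<lambda>k. cos ((t + 2 * pi * real k) / real p)) (mset_set {..<p})"
  have nat: "?M (t + 2 * real n * pi) = ?M t" for t n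
  proof (induction n)
    case (Suc n)
    have "?M (t + 2 * real (Suc n) * pi) = ?M (t + 2 * real n * pi + 2 * pi)"
      by (intro arg_cong[of _ _ ?M]) (simp add: algebra_simps)
    then show ?case
      using image_mset_cos_shift[OF assms(1), of "t + 2 * real n * pi"] Suc by simp
  qed simp
  have int: "?M (t + 2 * of_int m * pi) = ?M t" for t m
  proof (cases "m \<ge> 0")
    case True
    then show ?thesis using nat[of t "nat m"] by simp
  next
    case False
    then show ?thesis using nat[of "t + 2 * of_int m * pi" "nat (- m)"] by simp
  qed
  have canon: "?M t = ?M (arccos (cos t))" for t
  proof -
    obtain n :: int where "t = arccos (cos t) + 2 * of_int n * pi \<or> t = - arccos (cos t) + 2 * of_int n * pi"
      using cos_eq_arccos_Ex[of t "cos t"] by auto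
    then show ?thesis
      using int[of "arccos (cos t)" n] int[of "- arccos (cos t)" n] image_mset_cos_minus[OF assms(1), of "arccos (cos t)"]
      by metis
  qed
  show ?thesis
    using canon[of \<theta>] canon[of \<theta>'] assms(2) by simp
qed

text \<open>Perturbed angles may leave the square on which bands are defined; this folds them back
  without changing any count. Double sums of indicators allow one angle to be replaced at a
  time.\<close>

lemma card_energy_cong:
  assumes "p > 0" "q > 0" "cos \<theta> = cos \<theta>'" "cos \<phi> = cos \<phi>'"
  shows "card {i \<in> idx p q. P (energy p q \<theta> \<phi> i)} = card {i \<in> idx p q. P (energy p q \<theta>' \<phi>' i)}"
proof -
  have sum: "(\<Sum>k<n. g (cos ((s + 2 * pi * real k) / real n))) = (\<Sum>k<n. g (cos ((t + 2 * pi * real k) / real n)))"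
    if "n > 0" "cos s = cos t" for n s t and g :: "real \<Rightarrow> nat"
    using arg_cong[OF image_mset_cos_cong[OF that], of "\<lambda>M. sum_mset (image_mset g M)"]
    by (simp add: sum_unfold_sum_mset multiset.map_comp o_def)
  have card: "card {i \<in> idx p q. P (energy p q s t i)}
      = (\<Sum>k<p. \<Sum>l<q. of_bool (P (2 * cos ((s + 2 * pi * real k) / real p) + 2 * cos ((t + 2 * pi * real l) / real q))))"
    for s t
  proof -
    have "card {i \<in> idx p q. P (energy p q s t i)} = (\<Sum>i\<in>idx p q. of_bool (P (energy p q s t i)))"
      by (simp add: Int_def conj_commute)
    then show ?thesis
      by (simp only: sum.cartesian_product idx_def energy_def case_prod_unfold prod.sel fst_conv snd_conv)
  qed
  have inner: "(\<Sum>l<q. of_bool (P (2 * c + 2 * cos ((\<phi> + 2 * pi * real l) / real q))))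
      = (\<Sum>l<q. of_bool (P (2 * c + 2 * cos ((\<phi>' + 2 * pi * real l) / real q))) :: nat)" for c
    by (rule sum[OF assms(2,4), where g = "\<lambda>d. of_bool (P (2 * c + 2 * d))"])
  show ?thesis
    unfolding card inner
    by (rule sum[OF assms(1,3), where g = "\<lambda>c. \<Sum>l<q. of_bool (P (2 * c + 2 * cos ((\<phi>' + 2 * pi * real l) / real q)))"])
qed

text \<open>One ordered eigenvalue lies above \<open>E\<close> at the first pair of angles and below
  \<open>E\<close> at the second. Its band is a continuous image of a connected square, so it
  contains the open interval between these values.\<close>

lemma band_interior_if_crossing:
  assumes pq: "p > 0" "q > 0"
    and crossing: "\<exists>\<theta>1 \<phi>1 \<theta>2 \<phi>2. card {i \<in> idx p q. energy p q \<theta>1 \<phi>1 i \<le> E}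
      < card {i \<in> idx p q. energy p q \<theta>2 \<phi>2 i < E}"
  shows "\<exists>j \<in> {1..p * q}. E \<in> interior (band p q j)"
proof -
  obtain \<theta>1 \<phi>1 \<theta>2 \<phi>2 where
    less: "card {i \<in> idx p q. energy p q \<theta>1 \<phi>1 i \<le> E} < card {i \<in> idx p q. energy p q \<theta>2 \<phi>2 i < E}"
    using crossing by blast
  let ?a = "\<lambda>t. arccos (cos t)"
  \<comment> \<open>Any index above the first count and at most the second would do; the largest
    such index is taken.\<close>
  define j where "j = card {i \<in> idx p q. energy p q \<theta>2 \<phi>2 i < E}"
  have "j \<le> card (idx p q)"
    unfolding j_def by (intro card_mono) auto
  then have j: "j \<in> {1..p * q}"
    using less by (simp add: j_def)
  have a: "?a t \<in> {0..pi}" "cos (?a t) = cos t" for t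
    by (auto intro: arccos_lbound arccos_ubound cos_arccos)
  have up: "E < lam p q j (?a \<theta>1) (?a \<phi>1)"
    using lam_le_iff[OF pq j, of "?a \<theta>1" "?a \<phi>1" E] less
      card_energy_cong[OF pq a(2) a(2), of "\<lambda>x. x \<le> E" \<theta>1 \<phi>1] by (simp add: j_def)
  have lo: "lam p q j (?a \<theta>2) (?a \<phi>2) < E"
    using lam_less_iff[OF pq j, of "?a \<theta>2" "?a \<phi>2" E]
      card_energy_cong[OF pq a(2) a(2), of "\<lambda>x. x < E" \<theta>2 \<phi>2] by (simp add: j_def)
  have band: "band p q j = (\<lambda>s. lam p q j (fst s) (snd s)) ` ({0..pi} \<times> {0..pi})"
    unfolding band_def by force
  have "connected ({0..pi} \<times> {0..pi})"
    by (intro connected_Times) auto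
  then have "connected (band p q j)"
    unfolding band by (intro connected_continuous_image continuous_on_subset[OF continuous_on_lam[OF pq j]]) auto
  moreover have "lam p q j (?a \<theta>1) (?a \<phi>1) \<in> band p q j" "lam p q j (?a \<theta>2) (?a \<phi>2) \<in> band p q j"
    unfolding band_def using a(1) by blast+
  ultimately have "{lam p q j (?a \<theta>2) (?a \<phi>2) <..< lam p q j (?a \<theta>1) (?a \<phi>1)} \<subseteq> band p q j"
    using connected_contains_Icc[of "band p q j"] by fastforce
  then have "E \<in> interior (band p q j)"
    using up lo by (intro interiorI[OF open_greaterThanLessThan]) auto
  then show ?thesis using j by blast
qed

section \<open>Perturbation of the angles\<close>

lemma eventually_less_at_right:
  fixes f :: "real \<Rightarrow> real"
  assumes "(f has_real_derivative d) (at 0)" "d < 0"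
  shows "\<forall>\<^sub>F t in at_right 0. f t < f 0"
proof -
  obtain e where e: "e > 0" "\<And>h. 0 < h \<Longrightarrow> h < e \<Longrightarrow> f h < f 0"
    using DERIV_neg_dec_right[OF assms] by auto
  then show ?thesis
    unfolding eventually_at_right_field by blast
qed

lemma eventually_greater_at_right:
  fixes f :: "real \<Rightarrow> real"
  assumes "(f has_real_derivative d) (at 0)" "0 < d"
  shows "\<forall>\<^sub>F t in at_right 0. f 0 < f t"
  using eventually_less_at_right[of "\<lambda>t. - f t" "- d"] assms by (simp add: DERIV_minus)

text \<open>Energies strictly below \<open>E\<close> stay there by continuity, and the points of
  \<open>S\<close> on the level join them.\<close>

lemma eventually_card_less:
  fixes e :: "'b \<Rightarrow> 'a \<Rightarrow> real"
  assumes "finite I" and lim: "\<And>i. i \<in> I \<Longrightarrow> ((\<lambda>t. e t i) \<longlongrightarrow> e0 i) F"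
    and S: "S \<subseteq> {i \<in> I. e0 i = E}" and ev: "\<And>i. i \<in> S \<Longrightarrow> \<forall>\<^sub>F t in F. e t i < E"
  shows "\<forall>\<^sub>F t in F. card {i \<in> I. e0 i < E} + card S \<le> card {i \<in> I. e t i < E}"
proof -
  let ?L = "{i \<in> I. e0 i < E}"
  have fin: "finite S" "finite ?L"
    using S assms(1) by (auto intro: finite_subset)
  have "\<forall>\<^sub>F t in F. e t i < E" if "i \<in> ?L \<union> S" for i
    using that ev order_tendstoD(2)[OF lim] by blast
  then have "\<forall>\<^sub>F t in F. \<forall>i \<in> ?L \<union> S. e t i < E"
    using fin by (intro eventually_ball_finite) auto
  then show ?thesis
  proof eventually_elim
    case (elim t)
    have "card ?L + card S = card (?L \<union> S)"
      using fin S by (intro card_Un_disjoint[symmetric]) auto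
    also have "\<dots> \<le> card {i \<in> I. e t i < E}"
      using elim S assms(1) by (intro card_mono) auto
    finally show ?case .
  qed
qed

lemma card_filter_add_card_filter_not:
  assumes "finite I"
  shows "card {i \<in> I. P i} + card {i \<in> I. \<not> P i} = card I"
proof -
  have "card I = card ({i \<in> I. P i} \<union> {i \<in> I. \<not> P i})"
    by (rule arg_cong[of _ _ card]) auto
  then show ?thesis
    using assms by (subst (asm) card_Un_disjoint) auto
qed

text \<open>This is \<open>eventually_card_less\<close> for the negated energies at level
  \<open>-E\<close>; complements in \<open>I\<close> turn counts above \<open>E\<close> into counts
  at most \<open>E\<close>.\<close>

lemma eventually_card_le:
  fixes e :: "'b \<Rightarrow> 'a \<Rightarrow> real"
  assumes fin: "finite I" and lim: "\<And>i. i \<in> I \<Longrightarrow> ((\<lambda>t. e t i) \<longlongrightarrow> e0 i) F"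
    and S: "S \<subseteq> {i \<in> I. e0 i = E}" and ev: "\<And>i. i \<in> S \<Longrightarrow> \<forall>\<^sub>F t in F. E < e t i"
  shows "\<forall>\<^sub>F t in F. card {i \<in> I. e t i \<le> E} + card S \<le> card {i \<in> I. e0 i < E} + card {i \<in> I. e0 i = E}"
proof -
  note compl = card_filter_add_card_filter_not[OF fin]
  have less: "\<forall>\<^sub>F t in F. card {i \<in> I. - e0 i < - E} + card S \<le> card {i \<in> I. - e t i < - E}"
    using S ev by (intro eventually_card_less fin tendsto_minus lim) auto
  have total: "card {i \<in> I. e0 i < E} + card {i \<in> I. e0 i = E} + card {i \<in> I. E < e0 i} = card I"
  proof -
    have "{i \<in> I. e0 i \<le> E} = {i \<in> I. e0 i < E} \<union> {i \<in> I. e0 i = E}"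
      by auto
    then have "card {i \<in> I. e0 i \<le> E} = card {i \<in> I. e0 i < E} + card {i \<in> I. e0 i = E}"
      using fin by (simp add: card_Un_disjoint disjoint_iff)
    then show ?thesis
      using compl[of "\<lambda>i. e0 i \<le> E"] by (simp add: not_le)
  qed
  show ?thesis
    using less
  proof eventually_elim
    case (elim t)
    then show ?case
      using total compl[of "\<lambda>i. e t i \<le> E"] by (simp add: not_le)
  qed
qed

lemma tendsto_energy_at_right:
  assumes "p > 0" "q > 0"
  shows "((\<lambda>t. energy p q (\<theta> + a * t) (\<phi> + b * t) i) \<longlongrightarrow> energy p q \<theta> \<phi> i) (at_right 0)"
  using assms by (cases i) (auto simp: energy_def intro!: tendsto_eq_intros)

lemma energy_has_derivative:
  assumes "p > 0" "q > 0"
  shows "((\<lambda>t. energy p q (\<theta> + a * t) (\<phi> + b * t) (k, l)) has_real_derivative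
    - 2 * (sin ((\<theta> + 2 * pi * real k) / real p) * a / real p + sin ((\<phi> + 2 * pi * real l) / real q) * b / real q)) (at 0)"
proof -
  have d: "((\<lambda>t. 2 * cos ((s + c * t + u) / r)) has_real_derivative - 2 * (sin ((s + u) / r) * c / r)) (at 0)"
    if "r \<noteq> 0" for s c u r :: real
    using that by (auto intro!: derivative_eq_intros)
  have "real p \<noteq> 0" "real q \<noteq> 0" using assms by auto
  from DERIV_add[OF d[OF this(1)] d[OF this(2)]] show ?thesis
    unfolding energy_def case_prod_conv distrib_left .
qed

section \<open>Reflection of momenta and level sets\<close>

lemma cos_reflect: "q > 0 \<Longrightarrow> l \<le> q \<Longrightarrow> cos (2 * pi * real (q - l) / real q) = cos (2 * pi * real l / real q)"
  and sin_reflect: "q > 0 \<Longrightarrow> l \<le> q \<Longrightarrow> sin (2 * pi * real (q - l) / real q) = - sin (2 * pi * real l / real q)"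
proof -
  assume *: "q > 0" "l \<le> q"
  then have "2 * pi * real (q - l) / real q = 2 * pi - 2 * pi * real l / real q"
    by (simp add: of_nat_diff field_simps)
  then show "cos (2 * pi * real (q - l) / real q) = cos (2 * pi * real l / real q)"
    "sin (2 * pi * real (q - l) / real q) = - sin (2 * pi * real l / real q)"
    by simp_all
qed

text \<open>The reflection leaves the index range only at \<open>l = 0\<close>, where the sine
  vanishes.\<close>

lemma reflect_less: "sin (2 * pi * real l / real q) \<noteq> 0 \<Longrightarrow> l < q \<Longrightarrow> q - l < q"
  by (cases l) auto

text \<open>With second angle zero the energy is even in the second momentum and the sine is odd, so
  \<open>l \<mapsto> q - l\<close> exchanges the two sets.\<close>

lemma card_level_reflect_snd:
  "card {i \<in> idx p q. energy p q \<theta> 0 i = E \<and> sin (2 * pi * real (snd i) / real q) < 0}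
    = card {i \<in> idx p q. energy p q \<theta> 0 i = E \<and> 0 < sin (2 * pi * real (snd i) / real q)}"
  by (rule bij_betw_same_card[where f = "\<lambda>(k, l). (k, q - l)"],
      rule bij_betw_byWitness[where f' = "\<lambda>(k, l). (k, q - l)"])
    (auto simp: idx_def energy_def cos_reflect sin_reflect simp del: of_nat_diff intro: reflect_less)

lemma card_level_reflect_fst:
  "card {i \<in> idx p q. energy p q 0 \<phi> i = E \<and> sin (2 * pi * real (fst i) / real p) < 0}
    = card {i \<in> idx p q. energy p q 0 \<phi> i = E \<and> 0 < sin (2 * pi * real (fst i) / real p)}"
  by (rule bij_betw_same_card[where f = "\<lambda>(k, l). (p - k, l)"],
      rule bij_betw_byWitness[where f' = "\<lambda>(k, l). (p - k, l)"])
    (auto simp: idx_def energy_def cos_reflect sin_reflect simp del: of_nat_diff intro: reflect_less)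

text \<open>Handles points where the first derivative vanishes because the moving cosine is at an
  extremum.\<close>

lemma eventually_cos_less_1:
  fixes c :: real
  assumes "c > 0"
  shows "\<forall>\<^sub>F t in at_right 0. cos (t / c) < 1"
proof -
  have "cos (t / c) < 1" if "0 < t" "t < c * pi" for t
    using cos_monotone_0_pi[of 0 "t / c"] that assms by (simp add: field_simps)
  then show ?thesis
    unfolding eventually_at_right_field using assms by (intro exI[of _ "c * pi"]) auto
qed

lemma sin_eq_0_imp_cos: "sin x = 0 \<Longrightarrow> cos x = 1 \<or> cos x = - 1" for x :: real
  using sin_cos_squared_add[of x] by (simp add: power2_eq_1_iff)

text \<open>A zero of the sine means \<open>2 * k = m * p\<close> for an integer \<open>m\<close>,
  and \<open>k < p\<close> leaves only \<open>m = 0\<close> and \<open>m = 1\<close>.\<close>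

lemma sin_eq_0_index:
  assumes "sin (2 * pi * real k / real p) = 0" "k < p"
  shows "k = 0 \<or> 2 * k = p"
proof -
  obtain m :: int where "2 * pi * real k / real p = of_int m * pi"
    using assms(1) unfolding sin_zero_iff_int2 by auto
  then have "pi * (2 * real k) = pi * (of_int m * real p)"
    using assms(2) by (simp add: field_simps)
  then have "real_of_int (2 * int k) = real_of_int (m * int p)"
    by simp
  then have m: "2 * int k = m * int p"
    by (simp only: of_int_eq_iff)
  have "0 \<le> m * int p" "m * int p < 2 * int p"
    using m assms(2) by linarith+
  then have "m = 0 \<or> m = 1"
    using assms(2) by (auto simp: zero_le_mult_iff)
  then show ?thesis using m by auto
qed

section \<open>Crossings at nonzero energies\<close>

lemma exists_energy_crossing_pos:
  assumes pq: "p > 0" "q > 0" and E: "0 < E" "E < 4"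
  shows "\<exists>\<theta>1 \<phi>1 \<theta>2 \<phi>2. card {i \<in> idx p q. energy p q \<theta>1 \<phi>1 i \<le> E} < card {i \<in> idx p q. energy p q \<theta>2 \<phi>2 i < E}"
proof -
  \<comment> \<open>The bounds on \<open>E\<close> put \<open>E / 2 - 1\<close> in the domain of
    \<open>arccos\<close>. The index \<open>(0, 0)\<close> then has energy \<open>E\<close> and zero
    second momentum, which makes \<open>Z\<close> nonempty.\<close>
  define \<theta> where "\<theta> = real p * arccos (E / 2 - 1)"
  let ?x = "\<lambda>k. (\<theta> + 2 * pi * real k) / real p"
  let ?y = "\<lambda>l. 2 * pi * real l / real q"
  let ?e = "energy p q \<theta> 0"
  define M where "M = {i \<in> idx p q. ?e i = E}"
  define N where "N = card {i \<in> idx p q. ?e i < E}"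
  define U where "U = {i \<in> idx p q. ?e i = E \<and> 0 < sin (?y (snd i))}"
  define V where "V = {i \<in> idx p q. ?e i = E \<and> sin (?y (snd i)) < 0}"
  define Z where "Z = {i \<in> idx p q. ?e i = E \<and> sin (?y (snd i)) = 0}"
  have fin: "finite M" "finite U" "finite V" "finite Z"
    by (auto simp: M_def U_def V_def Z_def)
  have level: "2 * cos (?x k) + 2 * cos (?y l) = E" if "(k, l) \<in> M" for k l
    using that by (auto simp: M_def energy_def)
  have "card M = card (U \<union> V \<union> Z)"
    by (rule arg_cong[of _ _ card]) (auto simp: M_def U_def V_def Z_def)
  also have "\<dots> = card U + card V + card Z"
    using fin by (subst card_Un_disjoint; (subst card_Un_disjoint)?) (auto simp: U_def V_def Z_def)
  finally have card_M: "card M = 2 * card U + card Z"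
    using card_level_reflect_snd[of p q \<theta> E] by (simp add: U_def V_def)
  have "(0, 0) \<in> Z"
    using pq E by (simp add: Z_def idx_def energy_def \<theta>_def)
  then have card_Z: "card Z > 0"
    using fin by (auto simp: card_gt_0_iff)

  \<comment> \<open>Raising \<open>\<phi>\<close> moves exactly one of \<open>(k, l)\<close> and \<open>(k, q - l)\<close> below \<open>E\<close>; the remaining points \<open>Z\<close> lie
    at the maximum of the cosine in \<open>\<phi>\<close> and all move below.\<close>
  have "\<forall>\<^sub>F t in at_right 0. energy p q (\<theta> + 0 * t) (0 + 1 * t) i < E" if i: "i \<in> U \<union> Z" for i
  proof -
    obtain k l where kl: "i = (k, l)" by (cases i)
    have M: "(k, l) \<in> M" using i kl by (auto simp: M_def U_def Z_def)
    show ?thesis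
    proof (cases "i \<in> U")
      case True
      then have "0 < sin (?y l)" by (simp add: U_def kl)
      then show ?thesis
        using eventually_less_at_right[OF energy_has_derivative[OF pq, of \<theta> 0 0 1 k l]] pq M
        by (simp add: kl M_def)
    next
      case False
      then have "sin (?y l) = 0" using i by (simp add: Z_def kl)
      \<comment> \<open>The value \<open>-1\<close> would force
        \<open>2 * cos (?x k) = E + 2 > 2\<close>.\<close>
      moreover have "cos (?y l) \<noteq> - 1"
        using level[OF M] E cos_le_one[of "?x k"] by linarith
      ultimately have "cos (?y l) = 1" "sin (?y l) = 0"
        using sin_eq_0_imp_cos by blast+
      then have "energy p q \<theta> t (k, l) = 2 * cos (?x k) + 2 * cos (t / real q)" for t
        by (simp add: energy_def add_divide_distrib cos_add)
      then show ?thesis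
        using eventually_cos_less_1[of "real q"] pq level[OF M] \<open>cos (?y l) = 1\<close>
        by (auto simp: kl elim!: eventually_mono)
    qed
  qed
  then have "\<forall>\<^sub>F t in at_right 0. N + card (U \<union> Z) \<le> card {i \<in> idx p q. energy p q (\<theta> + 0 * t) (0 + 1 * t) i < E}"
    unfolding N_def
    by (intro eventually_card_less tendsto_energy_at_right pq) (auto simp: U_def Z_def)
  then obtain t2 where t2: "N + card (U \<union> Z) \<le> card {i \<in> idx p q. energy p q (\<theta> + 0 * t2) (0 + 1 * t2) i < E}"
    using eventually_happens'[OF trivial_limit_at_right_real] by blast
  have card_UZ: "card (U \<union> Z) = card U + card Z"
    using fin by (intro card_Un_disjoint) (auto simp: U_def Z_def)

  \<comment> \<open>If both sines vanished, both cosines would be \<open>1\<close> or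
    \<open>-1\<close> and the energy would be \<open>-4\<close>, \<open>0\<close> or
    \<open>4\<close>.\<close>
  have nonsing: "sin (?x k) \<noteq> 0 \<or> sin (?y l) \<noteq> 0" if "(k, l) \<in> M" for k l
    using level[OF that] E sin_eq_0_imp_cos[of "?x k"] sin_eq_0_imp_cos[of "?y l"] by auto
  \<comment> \<open>In a direction transversal to all gradients, the move or its opposite takes at least half of \<open>M\<close> above \<open>E\<close>.\<close>
  obtain c where c: "c \<notin> (\<lambda>(k, l). - sin (?x k) / sin (?y l)) ` M"
    using ex_new_if_finite[OF infinite_UNIV_char_0 finite_imageI[OF fin(1)]] by blast
  let ?g = "\<lambda>i. sin (?x (fst i)) + c * sin (?y (snd i))"
  have g: "?g i \<noteq> 0" if "i \<in> M" for i
  proof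
    assume 0: "?g i = 0"
    obtain k l where kl: "i = (k, l)" by (cases i)
    then have "sin (?y l) \<noteq> 0" using 0 nonsing that by auto
    then have "c = - sin (?x k) / sin (?y l)" using 0 kl by (simp add: field_simps)
    then show False using c that kl by force
  qed
  have "card M = card ({i \<in> M. ?g i < 0} \<union> {i \<in> M. - ?g i < 0})"
    using g by (intro arg_cong[of _ _ card]) force
  also have "\<dots> \<le> card {i \<in> M. ?g i < 0} + card {i \<in> M. - ?g i < 0}"
    by (rule card_Un_le)
  finally have "card M \<le> 2 * card {i \<in> M. 1 * ?g i < 0} \<or> card M \<le> 2 * card {i \<in> M. -1 * ?g i < 0}"
    by auto
  then obtain s :: real where s: "card M \<le> 2 * card {i \<in> M. s * ?g i < 0}"
    by blast
  let ?T = "{i \<in> M. s * ?g i < 0}"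
  have "\<forall>\<^sub>F t in at_right 0. E < energy p q (\<theta> + (real p * s) * t) (0 + (real q * c * s) * t) i" if i: "i \<in> ?T" for i
  proof -
    obtain k l where kl: "i = (k, l)" by (cases i)
    have "s * (sin (?x k) + c * sin (?y l)) < 0" using i kl by simp
    \<comment> \<open>The factors \<open>real p\<close> and \<open>real q\<close> in the direction
      cancel the denominators, so the derivative is \<open>-2 * s * ?g i\<close>.\<close>
    moreover have "- 2 * (sin (?x k) * (real p * s) / real p + sin ((0 + 2 * pi * real l) / real q) * (real q * c * s) / real q)
        = - 2 * (s * (sin (?x k) + c * sin (?y l)))"
      using pq by (simp add: distrib_left)
    ultimately have pos: "0 < - 2 * (sin (?x k) * (real p * s) / real p + sin ((0 + 2 * pi * real l) / real q) * (real q * c * s) / real q)"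
      by linarith
    have at_0: "energy p q (\<theta> + (real p * s) * 0) (0 + (real q * c * s) * 0) (k, l) = E"
      using i kl by (simp add: M_def)
    show ?thesis
      using eventually_greater_at_right[OF energy_has_derivative[OF pq] pos] unfolding kl at_0 .
  qed
  then have "\<forall>\<^sub>F t in at_right 0. card {i \<in> idx p q. energy p q (\<theta> + (real p * s) * t) (0 + (real q * c * s) * t) i \<le> E}
      + card ?T \<le> N + card M"
    unfolding N_def M_def
    by (intro eventually_card_le tendsto_energy_at_right pq) (auto simp: M_def)
  then obtain t1 where t1: "card {i \<in> idx p q. energy p q (\<theta> + (real p * s) * t1) (0 + (real q * c * s) * t1) i \<le> E}
      + card ?T \<le> N + card M"
    using eventually_happens'[OF trivial_limit_at_right_real] by blast
  \<comment> \<open>The left count is at most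
    \<open>N + card M / 2 = N + card U + card Z / 2\<close>, the right one at least
    \<open>N + card U + card Z\<close>, and \<open>Z\<close> is nonempty.\<close>
  have "card {i \<in> idx p q. energy p q (\<theta> + (real p * s) * t1) (0 + (real q * c * s) * t1) i \<le> E}
      < card {i \<in> idx p q. energy p q (\<theta> + 0 * t2) (0 + 1 * t2) i < E}"
    using t1 t2 s card_M card_Z card_UZ by linarith
  then show ?thesis by blast
qed

lemma exists_energy_crossing:
  assumes pq: "p > 0" "q > 0" and E: "-4 < E" "E < 4" "E \<noteq> 0"
  shows "\<exists>\<theta>1 \<phi>1 \<theta>2 \<phi>2. card {i \<in> idx p q. energy p q \<theta>1 \<phi>1 i \<le> E} < card {i \<in> idx p q. energy p q \<theta>2 \<phi>2 i < E}"
proof (cases "E > 0")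
  case True
  then show ?thesis using exists_energy_crossing_pos[OF pq] E by blast
next
  case False
  then have "0 < - E" "- E < 4" using E by auto
  from exists_energy_crossing_pos[OF pq this] obtain \<theta>1 \<phi>1 \<theta>2 \<phi>2 where
    less: "card {i \<in> idx p q. energy p q \<theta>1 \<phi>1 i \<le> - E} < card {i \<in> idx p q. energy p q \<theta>2 \<phi>2 i < - E}"
    by blast
  have neg: "energy p q (\<theta> + real p * pi) (\<phi> + real q * pi) i = - energy p q \<theta> \<phi> i" for \<theta> \<phi> i
  proof -
    have "(\<theta> + real p * pi + 2 * pi * real k) / real p = (\<theta> + 2 * pi * real k) / real p + pi"
      "(\<phi> + real q * pi + 2 * pi * real k) / real q = (\<phi> + 2 * pi * real k) / real q + pi" for k
      using pq by (simp_all add: field_simps)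
    then show ?thesis by (cases i) (simp add: energy_def)
  qed
  note compl = card_filter_add_card_filter_not[OF finite_idx]
  \<comment> \<open>Negating energies and taking complements reverses the inequality, so the two
    pairs of angles exchange roles.\<close>
  have "card {i \<in> idx p q. energy p q (\<theta>2 + real p * pi) (\<phi>2 + real q * pi) i \<le> E}
      < card {i \<in> idx p q. energy p q (\<theta>1 + real p * pi) (\<phi>1 + real q * pi) i < E}"
    using less compl[of p q "\<lambda>i. energy p q \<theta>1 \<phi>1 i \<le> - E"] compl[of p q "\<lambda>i. energy p q \<theta>2 \<phi>2 i < - E"]
    by (simp add: neg not_le not_less minus_le_iff minus_less_iff)
  then show ?thesis by blast
qed

section \<open>Crossing at energy zero\<close>

lemma exists_energy_crossing_0:
  assumes "odd p" "q > 0" "even q"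
  shows "\<exists>\<theta>1 \<phi>1 \<theta>2 \<phi>2. card {i \<in> idx p q. energy p q \<theta>1 \<phi>1 i \<le> 0} < card {i \<in> idx p q. energy p q \<theta>2 \<phi>2 i < 0}"
proof -
  have pq: "p > 0" "q > 0" using assms by (auto intro: Nat.gr0I)
  let ?x = "\<lambda>k. 2 * pi * real k / real p"
  let ?y = "\<lambda>l. 2 * pi * real l / real q"
  let ?e = "energy p q 0 0"
  define M where "M = {i \<in> idx p q. ?e i = 0}"
  define N where "N = card {i \<in> idx p q. ?e i < 0}"
  define X where "X = {i \<in> idx p q. ?e i = 0 \<and> 0 < sin (?x (fst i))}"
  define X' where "X' = {i \<in> idx p q. ?e i = 0 \<and> sin (?x (fst i)) < 0}"
  define Y where "Y = {i \<in> idx p q. ?e i = 0 \<and> sin (?y (snd i)) < 0}"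
  define Y' where "Y' = {i \<in> idx p q. ?e i = 0 \<and> 0 < sin (?y (snd i))}"
  \<comment> \<open>The singular point \<open>(0, \<pi>)\<close> of \<open>cos x + cos y = 0\<close>; the other one, \<open>(\<pi>, 0)\<close>, is missed because \<open>p\<close> is odd.\<close>
  define saddle where "saddle = (0 :: nat, q div 2)"
  have fin: "finite M" "finite X" "finite X'" "finite Y" "finite Y'"
    by (auto simp: M_def X_def X'_def Y_def Y'_def)
  have y_half: "?y (q div 2) = pi"
    using assms by (auto elim!: evenE)
  have saddle: "saddle \<in> M"
    using pq y_half by (simp add: saddle_def M_def idx_def energy_def)
  \<comment> \<open>A vanishing sine leaves \<open>k = 0\<close> since \<open>p\<close> is odd; the
    level equation then forces second momentum \<open>pi\<close>.\<close>
  have sinx: "i = saddle" if "i \<in> M" "sin (?x (fst i)) = 0" for i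
  proof -
    obtain k l where kl: "i = (k, l)" by (cases i)
    have less: "k < p" "l < q" and cos: "cos (?x k) = - cos (?y l)"
      using that(1) kl by (auto simp: M_def idx_def energy_def)
    have "k = 0"
      using sin_eq_0_index[of k p] less that(2) kl assms(1) by (auto simp: even_two_times_div_two)
    then have "cos (?y l) = - 1" using cos by simp
    then have "sin (?y l) = 0"
      using sin_cos_squared_add[of "?y l"] by simp
    then have "2 * l = q"
      using sin_eq_0_index[of l q] less \<open>cos (?y l) = - 1\<close> by auto
    then show ?thesis using \<open>k = 0\<close> kl by (simp add: saddle_def)
  qed
  \<comment> \<open>On the level set the two cosines are opposite, so the two sines vanish together
    and \<open>sinx\<close> applies.\<close>
  have siny: "i = saddle" if "i \<in> M" "sin (?y (snd i)) = 0" for i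
  proof -
    obtain k l where kl: "i = (k, l)" by (cases i)
    have "cos (?x k) = - cos (?y l)"
      using that(1) kl by (auto simp: M_def energy_def)
    moreover have "cos (?y l) = 1 \<or> cos (?y l) = - 1"
      using sin_eq_0_imp_cos that(2) kl by simp
    ultimately have "(cos (?x k))\<^sup>2 = 1" by auto
    then have "sin (?x k) = 0"
      using sin_cos_squared_add[of "?x k"] by simp
    then show ?thesis using sinx that(1) kl by simp
  qed
  have sin_saddle: "sin (?x (fst saddle)) = 0" "sin (?y (snd saddle)) = 0"
    unfolding saddle_def snd_conv y_half by simp_all
  \<comment> \<open>Apart from the saddle, reflection pairs the points of \<open>M\<close>. Doing
    this in each coordinate shows that \<open>X\<close> and \<open>Y\<close> both have
    \<open>(card M - 1) / 2\<close> elements.\<close>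
  have "card M = card (insert saddle (X \<union> X'))"
    using saddle sinx by (intro arg_cong[of _ _ card]) (force simp: M_def X_def X'_def)
  also have "\<dots> = Suc (card X + card X')"
  proof -
    have "saddle \<notin> X \<union> X'" "X \<inter> X' = {}"
      using sin_saddle by (auto simp: X_def X'_def)
    then show ?thesis using fin by (simp add: card_Un_disjoint)
  qed
  finally have card_X: "card M = 2 * card X + 1"
    using card_level_reflect_fst[of p q 0 0] by (simp add: X_def X'_def)
  have "card M = card (insert saddle (Y \<union> Y'))"
    using saddle siny by (intro arg_cong[of _ _ card]) (force simp: M_def Y_def Y'_def)
  also have "\<dots> = Suc (card Y + card Y')"
  proof -
    have "saddle \<notin> Y \<union> Y'" "Y \<inter> Y' = {}"
      using sin_saddle by (auto simp: Y_def Y'_def)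
    then show ?thesis using fin by (simp add: card_Un_disjoint)
  qed
  finally have card_Y: "card M = 2 * card Y + 1"
    using card_level_reflect_snd[of p q 0 0] by (simp add: Y_def Y'_def)

  have "\<forall>\<^sub>F t in at_right 0. energy p q (0 + 1 * t) (0 + 0 * t) i < 0" if i: "i \<in> insert saddle X" for i
  proof (cases "i = saddle")
    case True
    have "energy p q t 0 saddle = 2 * cos (t / real p) - 2" for t
      unfolding energy_def saddle_def using y_half by simp
    then show ?thesis
      using eventually_cos_less_1[of "real p"] pq True by simp
  next
    case False
    obtain k l where kl: "i = (k, l)" by (cases i)
    from False i have "0 < sin (?x k)" "energy p q 0 0 (k, l) = 0" by (auto simp: X_def kl)
    then show ?thesis
      using eventually_less_at_right[OF energy_has_derivative[OF pq, of 0 1 0 0 k l]] pq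
      by (simp add: kl)
  qed
  then have "\<forall>\<^sub>F t in at_right 0. N + card (insert saddle X) \<le> card {i \<in> idx p q. energy p q (0 + 1 * t) (0 + 0 * t) i < 0}"
    unfolding N_def using saddle
    by (intro eventually_card_less tendsto_energy_at_right pq) (auto simp: X_def M_def)
  then obtain t2 where t2: "N + card (insert saddle X) \<le> card {i \<in> idx p q. energy p q (0 + 1 * t2) (0 + 0 * t2) i < 0}"
    using eventually_happens'[OF trivial_limit_at_right_real] by blast

  have "\<forall>\<^sub>F t in at_right 0. 0 < energy p q (0 + 0 * t) (0 + 1 * t) i" if i: "i \<in> insert saddle Y" for i
  proof (cases "i = saddle")
    case True
    have "energy p q 0 t saddle = 2 - 2 * cos (t / real q)" for t
      unfolding energy_def saddle_def using y_half by (simp add: add_divide_distrib)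
    then show ?thesis
      using eventually_cos_less_1[of "real q"] pq True by simp
  next
    case False
    obtain k l where kl: "i = (k, l)" by (cases i)
    from False i have "sin (?y l) < 0" "energy p q 0 0 (k, l) = 0" by (auto simp: Y_def kl)
    then show ?thesis
      using eventually_greater_at_right[OF energy_has_derivative[OF pq, of 0 0 0 1 k l]] pq
      by (simp add: kl divide_less_0_iff)
  qed
  then have "\<forall>\<^sub>F t in at_right 0. card {i \<in> idx p q. energy p q (0 + 0 * t) (0 + 1 * t) i \<le> 0} + card (insert saddle Y) \<le> N + card M"
    unfolding N_def M_def using saddle
    by (intro eventually_card_le tendsto_energy_at_right pq) (auto simp: Y_def M_def)
  then obtain t1 where t1: "card {i \<in> idx p q. energy p q (0 + 0 * t1) (0 + 1 * t1) i \<le> 0} + card (insert saddle Y) \<le> N + card M"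
    using eventually_happens'[OF trivial_limit_at_right_real] by blast
  have "card (insert saddle X) = Suc (card X)" "card (insert saddle Y) = Suc (card Y)"
    using fin sin_saddle by (auto simp: X_def Y_def)
  \<comment> \<open>The left count is at most \<open>N + card M - (card Y + 1) = N + card X\<close>,
    the right one at least \<open>N + card X + 1\<close>; the saddle, counted in both moves,
    supplies the strict gap.\<close>
  then have "card {i \<in> idx p q. energy p q (0 + 0 * t1) (0 + 1 * t1) i \<le> 0}
      < card {i \<in> idx p q. energy p q (0 + 1 * t2) (0 + 0 * t2) i < 0}"
    using t1 t2 card_X card_Y by linarith
  then show ?thesis by blast
qed

theorem theorem3p1:
  shows "(\<forall>r::nat. r > 0 \<and> even r \<longrightarrow>
            (\<forall>E::real. E \<in> {-4<..<4} - {0} \<longrightarrow>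
               (\<exists>j \<in> {1..r^2}. E \<in> interior (band r r j))))
       \<and> (\<forall>p q::nat. odd p \<and> q > 0 \<and> 4 dvd q \<longrightarrow>
            (\<exists>j \<in> {1..p*q}. (0::real) \<in> interior (band p q j)))"
proof (intro conjI allI impI)
  fix r :: nat and E :: real
  assume "r > 0 \<and> even r" "E \<in> {-4<..<4} - {0}"
  then have "r > 0" "-4 < E" "E < 4" "E \<noteq> 0" by auto
  then show "\<exists>j \<in> {1..r^2}. E \<in> interior (band r r j)"
    unfolding power2_eq_square
    by (intro band_interior_if_crossing exists_energy_crossing)
next
  fix p q :: nat
  assume pq: "odd p \<and> q > 0 \<and> 4 dvd q"
  then have "odd p" "q > 0" "even q"
    using dvd_trans[of 2 4 q] by auto
  moreover from \<open>odd p\<close> have "p > 0"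
    by (rule odd_pos)
  ultimately show "\<exists>j \<in> {1..p*q}. 0 \<in> interior (band p q j)"
    by (intro band_interior_if_crossing exists_energy_crossing_0)
qed

end
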